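(* Let $R$ be a locally associated order in a number field $K$, with integral closure $\overline{R}=\mathcal{O}_K$, whose conductor ideal is $I=(R:\overline{R})=P^a$, where $P=\pi\overline{R}$ is a principal prime ideal of $\overline{R}$ and $a\geq 2$. Assume also that $R\cap P=I$ and $\rho(\overline{R})\geq\frac{2a-1}{a}$. Then $\rho(R)=\rho(\overline{R})$, but $R$ is not an associated order.
   Context: An order $R$ in a number field $K$ is a subring of the ring of integers $\mathcal{O}_K=\overline{R}$ of finite index. Its conductor ideal is $I=(R:\overline{R})=\{x\in\overline{R}: x\overline{R}\subseteq R\}$. $U(\cdot)$ denotes the unit group. $R$ is locally associated if for every $\alpha\in\overline{R}$ with $\alpha\overline{R}+I=\overline{R}$ there is $u\in U(\overline{R})$ with $u\alpha\in R$; equivalently, the natural surjection $\mathrm{Cl}(R)\to\mathrm{Cl}(\overline{R})$, $[J]\mapsto[J\overline{R}]$, of class groups (invertible fractional ideals modulo nonzero principal ones) is an isomorphism. $R$ is associated if $\overline{R}=R\cdot U(\overline{R})$, i.e. for every $\alpha\in\overline{R}$ there is $u\in U(\overline{R})$ with $u\alpha\in R$. Elasticity: for a nonzero nonunit $\alpha\in R$, let $\ell_R(\alpha)$ be the set of $k\in\mathbb{N}$ such that $\alpha$ is a product of $k$ irreducible elements of $R$; $\rho_R(\alpha)=\sup\{m/n: m,n\in\ell_R(\alpha)\}$, and $\rho(R)=\sup\{\rho_R(\alpha):\alpha\in R\text{ a nonzero nonunit}\}$ (and likewise for $\overline{R}$). *)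

theory Defs
  imports "HOL-Algebra.Algebra" "HOL-Library.Extended_Nonnegative_Real"
begin

text \<open>The set \<open>generate_field K {}\<close> is the prime subfield of \<open>K\<close>,
  which is a copy of the rational numbers when the characteristic is zero.\<close>

locale number_field = field K for K (structure) +
  assumes char_zero: "(n::nat) > 0 \<Longrightarrow> [n] \<cdot> \<one> \<noteq> \<zero>"
    and finite_degree: "finite_dimension (generate_field K {}) (carrier K)"

text \<open>The set \<open>generate_ring K {}\<close> is the image of the integers in \<open>K\<close>. Polynomials are coefficient
  lists with the leading coefficient first; the zero polynomial \<open>[]\<close> has to be excluded
  explicitly, because its leading coefficient \<open>hd []\<close> is unspecified.\<close>

definition integers_of :: "('a, 'b) ring_scheme \<Rightarrow> 'a set" where
  "integers_of K = {x \<in> carrier K. \<exists>p \<in> carrier (univ_poly K (generate_ring K {})).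
     p \<noteq> [] \<and> lead_coeff p = \<one>\<^bsub>K\<^esub> \<and> ring.eval K p x = \<zero>\<^bsub>K\<^esub>}"

definition ring_of_integers :: "('a, 'b) ring_scheme \<Rightarrow> ('a, 'b) ring_scheme" where
  "ring_of_integers K = K\<lparr>carrier := integers_of K\<rparr>"

definition order_in :: "('a, 'b) ring_scheme \<Rightarrow> 'a set \<Rightarrow> bool" where
  "order_in K R \<longleftrightarrow> subring R (ring_of_integers K) \<and> finite (a_rcosets\<^bsub>ring_of_integers K\<^esub> R)"

definition conductor :: "('a, 'b) ring_scheme \<Rightarrow> 'a set \<Rightarrow> 'a set" where
  "conductor K R = {x \<in> integers_of K. \<forall>y \<in> integers_of K. x \<otimes>\<^bsub>K\<^esub> y \<in> R}"

definition locally_associated_order :: "('a, 'b) ring_scheme \<Rightarrow> 'a set \<Rightarrow> bool" where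
  "locally_associated_order K R \<longleftrightarrow>
     (\<forall>\<alpha> \<in> integers_of K.
        (PIdl\<^bsub>ring_of_integers K\<^esub> \<alpha>) <+>\<^bsub>ring_of_integers K\<^esub> conductor K R = integers_of K
        \<longrightarrow> (\<exists>u \<in> Units (ring_of_integers K). u \<otimes>\<^bsub>K\<^esub> \<alpha> \<in> R))"

definition associated_order :: "('a, 'b) ring_scheme \<Rightarrow> 'a set \<Rightarrow> bool" where
  "associated_order K R \<longleftrightarrow>
     (\<forall>\<alpha> \<in> integers_of K. \<exists>u \<in> Units (ring_of_integers K). u \<otimes>\<^bsub>K\<^esub> \<alpha> \<in> R)"

text \<open>Factorizations are taken in the cancellative monoid \<open>mult_of S\<close> of nonzero elements of the
  domain \<open>S\<close>. The explicit carrier condition is needed since \<^const>\<open>irreducible\<close> does not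
  imply membership in the carrier.\<close>

definition factorization_lengths :: "('a, 'b) ring_scheme \<Rightarrow> 'a \<Rightarrow> nat set" where
  "factorization_lengths S \<alpha> =
     {length fs | fs. set fs \<subseteq> carrier (mult_of S) \<and> factors (mult_of S) fs \<alpha>}"

text \<open>Lengths of nonunits are positive, so no division by zero occurs in \<open>elasticity\<close>.
  The value may be infinite.\<close>

definition element_elasticity :: "('a, 'b) ring_scheme \<Rightarrow> 'a \<Rightarrow> ennreal" where
  "element_elasticity S \<alpha> =
     (SUP m \<in> factorization_lengths S \<alpha>. SUP n \<in> factorization_lengths S \<alpha>.
        ennreal (real m / real n))"

definition elasticity :: "('a, 'b) ring_scheme \<Rightarrow> ennreal" where
  "elasticity S = (SUP \<alpha> \<in> carrier S - {\<zero>\<^bsub>S\<^esub>} - Units S. element_elasticity S \<alpha>)"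

end

theory Submission
  imports Defs
begin

text \<open>Write \<open>O\<close> for the ring of integers. Since \<open>R \<inter> P = P\<^sup>a\<close> with \<open>a \<ge> 2\<close>, multiplication by \<open>\<pi>\<close>
  embeds \<open>O/P\<close> into the finite group \<open>O/R\<close>, so \<open>P\<close> is maximal. Hence every element of \<open>O\<close> outside \<open>P\<close>
  has an associate in \<open>R\<close>, and \<open>R - P\<close> has the same factorizations as \<open>O - P\<close> up to units of \<open>O\<close>.
  The irreducible elements of \<open>R\<close> inside \<open>P\<close> are the \<open>u \<pi>\<^sup>j\<close> with \<open>u\<close> a unit of \<open>O\<close> and
  \<open>a \<le> j \<le> 2a - 1\<close>. Therefore a factorization of \<open>\<pi>\<^sup>k y\<close>, \<open>y \<notin> P\<close>, has length \<open>k + q\<close> in \<open>O\<close>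
  and \<open>s + q\<close> with \<open>k / (2a - 1) \<le> s \<le> k / a\<close> in \<open>R\<close>, where \<open>q\<close> is a length of \<open>y\<close> in \<open>O\<close>. The quotients of
  such lengths are mediants, which gives both inequalities between the elasticities.
  Finally, no associate of \<open>\<pi>\<close> lies in \<open>R\<close>, because it would lie in \<open>R \<inter> P = \<pi>\<^sup>a O\<close>.\<close>

subsection \<open>Subrings of finite index and principal ideals\<close>

text \<open>Two of the elements \<open>f 0\<close>, ..., \<open>f N\<close>, with \<open>N\<close>
  the index of \<open>H\<close>, lie in the same coset. The bound on \<open>j\<close> makes the
  multiplier in \<open>finite_index_fact_mult\<close> uniform in \<open>x\<close>.\<close>

lemma (in ring) finite_index_pigeonhole:
  fixes f :: "nat \<Rightarrow> 'a"
  assumes "subring H R" "finite (a_rcosets H)" "\<And>n. f n \<in> carrier R"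
  shows "\<exists>i j. i < j \<and> j \<le> card (a_rcosets H) \<and> f j \<ominus> f i \<in> H"
proof -
  interpret abelian_subgroup H R
    using subring.axioms(1)[OF assms(1)] abelian_group_axioms
    by (intro abelian_subgroupI3 additive_subgroup.intro)
  have "(\<lambda>n. H +> f n) ` {..card (a_rcosets H)} \<subseteq> a_rcosets H"
    using assms(3) a_rcosetsI a_subset by blast
  then have "card ((\<lambda>n. H +> f n) ` {..card (a_rcosets H)}) < card {..card (a_rcosets H)}"
    using card_mono[OF assms(2)] by (simp add: less_Suc_eq_le)
  then obtain i j where ij: "i \<le> card (a_rcosets H)" "j \<le> card (a_rcosets H)"
      "i \<noteq> j" "H +> f i = H +> f j"
    using pigeonhole[of "\<lambda>n. H +> f n" "{..card (a_rcosets H)}"] unfolding inj_on_def by blast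
  have diff: "f l \<ominus> f k \<in> H" if "H +> f k = H +> f l" for k l
    using a_rcos_module_minus[OF ring_axioms, of "f k" "f l"] a_rcos_self[of "f l"] that assms(3)
    by metis
  show ?thesis
    using ij diff by (metis linorder_neqE_nat)
qed

text \<open>Two multiples of \<open>x\<close> collide modulo \<open>H\<close>, so some
  \<open>d\<close> between 1 and the index multiplies \<open>x\<close> into \<open>H\<close>. Each
  such \<open>d\<close> divides the factorial, which therefore works for all \<open>x\<close> at
  once.\<close>

lemma (in ring) finite_index_fact_mult:
  assumes "subring H R" "finite (a_rcosets H)" "x \<in> carrier R"
  shows "add_pow R (fact (card (a_rcosets H)) :: nat) x \<in> H"
proof -
  have closed: "add_pow R n x \<in> carrier R" for n :: nat
    using assms(3) by simp
  obtain i j where ij: "i < j" "j \<le> card (a_rcosets H)" "add_pow R j x \<ominus> add_pow R i x \<in> H"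
    using finite_index_pigeonhole[OF assms(1,2), of "\<lambda>n. add_pow R n x"] closed by blast
  have "add_pow R j x = add_pow R (j - i) x \<oplus> add_pow R i x"
    using ij(1) assms(3) by (simp add: add.nat_pow_mult)
  then have "add_pow R j x \<ominus> add_pow R i x = add_pow R (j - i) x"
    using closed by algebra
  then have mem: "add_pow R (j - i) x \<in> H"
    using ij(3) by simp
  have "add_pow R k y \<in> H" if "y \<in> H" for y and k :: nat
    using that subringE(2,7)[OF assms(1)] by (induction k) (auto simp: add.nat_pow_0 add.nat_pow_Suc)
  moreover have "j - i dvd fact (card (a_rcosets H))"
    using ij by (intro dvd_fact) auto
  then obtain k where "fact (card (a_rcosets H)) = (j - i) * k"
    by (auto simp: dvd_def)
  ultimately show ?thesis
    using mem add.nat_pow_pow[OF assms(3), of k "j - i"] by metis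
qed

text \<open>By \<open>cgenideal_prod\<close> the plain set of products is already a principal ideal,
  so the closure under sums in \<open>ideal_prod\<close> adds nothing.\<close>

lemma (in cring) cgenideal_ideal_prod:
  assumes "x \<in> carrier R" "y \<in> carrier R"
  shows "ideal_prod R (PIdl x) (PIdl y) = PIdl (x \<otimes> y)"
proof
  show "ideal_prod R (PIdl x) (PIdl y) \<subseteq> PIdl (x \<otimes> y)"
  proof
    fix z assume "z \<in> ideal_prod R (PIdl x) (PIdl y)"
    then show "z \<in> PIdl (x \<otimes> y)"
    proof induction
      case (prod i j)
      then have "i \<otimes> j \<in> PIdl x <#> PIdl y"
        unfolding set_mult_def by blast
      then show ?case
        using cgenideal_prod[OF assms] by simp
    next
      case (sum s t)
      then show ?case
        using cgenideal_ideal[of "x \<otimes> y"] assms by (meson additive_subgroup.a_closed ideal.axioms(1) m_closed)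
    qed
  qed
  have "PIdl x <#> PIdl y \<subseteq> ideal_prod R (PIdl x) (PIdl y)"
    unfolding set_mult_def by (auto intro: ideal_prod.prod)
  then show "PIdl (x \<otimes> y) \<subseteq> ideal_prod R (PIdl x) (PIdl y)"
    using cgenideal_prod[OF assms] by simp
qed

lemma (in cring) cgenideal_nat_pow:
  assumes "x \<in> carrier R"
  shows "(PIdl x) [^]\<^bsub>ideals_set R\<^esub> (n::nat) = PIdl (x [^] n)"
proof (induction n)
  case 0
  have "PIdl \<one> = carrier R"
    using ideal_eq_carrier_iff[of \<one>] by simp
  then show ?case
    by (simp add: ideals_set_def)
next
  case (Suc n)
  then show ?case
    using assms cgenideal_ideal_prod[of "x [^] n" x] by (simp add: ideals_set_def)
qed

lemma (in cring) Units_of_mult: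
  assumes "x \<in> carrier R" "y \<in> carrier R" "x \<otimes> y \<in> Units R"
  shows "x \<in> Units R" "y \<in> Units R"
  using assms unit_factor[of x y] unit_factor[of y x] m_comm[of x y] by auto

text \<open>Lets a unit pass from one factor to the other; factors are moved into \<open>R\<close>
  in this way.\<close>

lemma (in cring) Units_inv_mult_cancel:
  assumes "u \<in> Units R" "x \<in> carrier R" "y \<in> carrier R"
  shows "(u \<otimes> x) \<otimes> (inv u \<otimes> y) = x \<otimes> y" "(x \<otimes> inv u) \<otimes> (u \<otimes> y) = x \<otimes> y"
proof -
  have i: "inv u \<in> carrier R" "u \<in> carrier R" "u \<otimes> inv u = \<one>"
    using assms by auto
  have "(u \<otimes> x) \<otimes> (inv u \<otimes> y) = (u \<otimes> inv u) \<otimes> (x \<otimes> y)"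
      "(x \<otimes> inv u) \<otimes> (u \<otimes> y) = (u \<otimes> inv u) \<otimes> (x \<otimes> y)"
    using assms(2,3) i(1,2) by algebra+
  then show "(u \<otimes> x) \<otimes> (inv u \<otimes> y) = x \<otimes> y" "(x \<otimes> inv u) \<otimes> (u \<otimes> y) = x \<otimes> y"
    using i assms by simp_all
qed

lemma (in cring) nat_pow_diff_split:
  fixes i j :: nat
  assumes "x \<in> carrier R" "i < j"
  shows "x [^] j \<ominus> x [^] i = \<ominus> (x [^] i \<otimes> (\<one> \<ominus> x [^] (j - i)))"
proof -
  have "x [^] j = x [^] i \<otimes> x [^] (j - i)"
    using assms by (simp add: nat_pow_mult)
  then show ?thesis
    using assms(1) by (simp add: minus_eq r_distr minus_add r_minus a_comm)
qed

subsection \<open>Factorization lengths\<close>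

context domain
begin

lemma ring_irreducible_mult_unit:
  assumes "x \<in> carrier R" "ring_irreducible x" "u \<in> Units R"
  shows "ring_irreducible (u \<otimes> x)"
proof (rule ring_irreducibleI)
  have u: "u \<in> carrier R" "u \<noteq> \<zero>"
    using assms(3) by (auto simp: Units_def)
  then show "u \<otimes> x \<in> carrier R - {\<zero>}"
    using ring_irreducibleE(1)[OF assms(1,2)] assms(1) integral_iff by auto
  show "u \<otimes> x \<notin> Units R"
    using ring_irreducibleE(4)[OF assms(1,2)] u assms(1) Units_of_mult(2) by blast
  fix b c assume bc: "b \<in> carrier R" "c \<in> carrier R" "u \<otimes> x = b \<otimes> c"
  then have "x = (inv u \<otimes> b) \<otimes> c"
    using assms by (metis Units_inv_closed Units_l_inv l_one m_assoc u(1))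
  then have "inv u \<otimes> b \<in> Units R \<or> c \<in> Units R"
    using ring_irreducibleE(5)[OF assms(1,2)] bc assms(3) by simp
  then show "b \<in> Units R \<or> c \<in> Units R"
    using Units_of_mult(2) bc assms(3) by blast
qed

text \<open>\<open>factors\<close> requires the product to equal \<open>x\<close> exactly, not up to
  a unit, so a unit other than \<open>\<one>\<close> has no lengths at all. For this reason the
  decomposition lemmas below carry a unit \<open>u\<close> in front of \<open>y\<close>.\<close>

lemma factorization_lengths_0:
  "0 \<in> factorization_lengths R x \<longleftrightarrow> x = \<one>"
  unfolding factorization_lengths_def by (auto simp: factors_def)

text \<open>Together with \<open>factorization_lengths_0\<close> this recursion replaces the list of
  factors, so that later arguments go by induction on the length.\<close>

lemma factorization_lengths_Suc:
  "Suc n \<in> factorization_lengths R x \<longleftrightarrow>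
     (\<exists>b c. b \<in> carrier R \<and> ring_irreducible b \<and> n \<in> factorization_lengths R c \<and> x = b \<otimes> c)"
    (is "?l \<longleftrightarrow> ?r")
proof
  assume ?l
  then obtain fs where fs: "length fs = Suc n" "set fs \<subseteq> carrier (mult_of R)" "factors (mult_of R) fs x"
    unfolding factorization_lengths_def by auto
  then obtain b gs where "fs = b # gs"
    by (cases fs) auto
  then show ?r
    using fs ring_irreducibleI'[of b]
    unfolding factorization_lengths_def by (fastforce simp: factors_def)
next
  assume ?r
  then obtain b c fs where "b \<in> carrier R" "ring_irreducible b" "x = b \<otimes> c"
      "length fs = n" "set fs \<subseteq> carrier (mult_of R)" "factors (mult_of R) fs c"
    unfolding factorization_lengths_def by auto
  then have "length (b # fs) = Suc n \<and> set (b # fs) \<subseteq> carrier (mult_of R) \<and>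
      factors (mult_of R) (b # fs) x"
    using ring_irreducibleE(1,3)[of b] by (auto simp: factors_def)
  then show ?l
    unfolding factorization_lengths_def by (metis (mono_tags, lifting) mem_Collect_eq)
qed

lemma factorization_lengths_closed:
  "n \<in> factorization_lengths R x \<Longrightarrow> x \<in> carrier R \<and> x \<noteq> \<zero>"
proof (induction n arbitrary: x)
  case 0
  then show ?case by (simp add: factorization_lengths_0)
next
  case (Suc n)
  then obtain b c where "b \<in> carrier R" "ring_irreducible b" "n \<in> factorization_lengths R c" "x = b \<otimes> c"
    by (auto simp: factorization_lengths_Suc)
  then show ?case
    using Suc.IH[of c] ring_irreducibleE(1)[of b] integral_iff by auto
qed

lemma factorization_lengths_unit:
  assumes "n \<in> factorization_lengths R x" "x \<in> Units R"
  shows "n = 0"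
proof (cases n)
  case (Suc m)
  then obtain b c where "b \<in> carrier R" "ring_irreducible b" "m \<in> factorization_lengths R c" "x = b \<otimes> c"
    using assms(1) by (auto simp: factorization_lengths_Suc)
  then show ?thesis
    using assms(2) Units_of_mult(1) factorization_lengths_closed ring_irreducibleE(4) by metis
qed

text \<open>The unit is absorbed by the first irreducible factor, which exists because
  \<open>n\<close> is not zero.\<close>

lemma factorization_lengths_mult_unit:
  assumes "n \<in> factorization_lengths R x" "n \<noteq> 0" "u \<in> Units R"
  shows "n \<in> factorization_lengths R (u \<otimes> x)"
proof (cases n)
  case (Suc m)
  then obtain b c where bc: "b \<in> carrier R" "ring_irreducible b" "m \<in> factorization_lengths R c" "x = b \<otimes> c"
    using assms(1) by (auto simp: factorization_lengths_Suc)
  have "u \<otimes> b \<in> carrier R" "ring_irreducible (u \<otimes> b)" "u \<otimes> x = (u \<otimes> b) \<otimes> c"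
    using bc assms(3) ring_irreducible_mult_unit factorization_lengths_closed[OF bc(3)] by (auto simp: m_assoc Units_closed)
  then show ?thesis
    using bc(3) Suc unfolding Suc factorization_lengths_Suc by blast
qed (use assms in simp)

text \<open>A unit has no irreducible divisors; for a nonunit \<open>x\<close> the inverse of
  \<open>u\<close> is absorbed by a factor.\<close>

lemma factorization_lengths_associated:
  assumes "n \<in> factorization_lengths R (u \<otimes> x)" "u \<in> Units R" "x \<in> carrier R"
  shows "x \<in> Units R \<Longrightarrow> n = 0" "x \<notin> Units R \<Longrightarrow> n \<noteq> 0 \<and> n \<in> factorization_lengths R x"
proof -
  show "n = 0" if "x \<in> Units R"
    using factorization_lengths_unit[OF assms(1)] that assms(2) by simp
  assume x: "x \<notin> Units R"
  have "n \<noteq> 0"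
  proof
    assume "n = 0"
    then have "u \<otimes> x = \<one>"
      using assms(1) factorization_lengths_0 by simp
    then show False
      using x Units_of_mult(2)[of u x] assms(2,3) by auto
  qed
  moreover have "inv u \<otimes> (u \<otimes> x) = x"
    using assms(2,3) by (simp add: m_assoc[symmetric] Units_closed)
  ultimately show "n \<noteq> 0 \<and> n \<in> factorization_lengths R x"
    using factorization_lengths_mult_unit[OF assms(1), of "inv u"] assms(2) by simp
qed

lemma factorization_lengths_ratio_le:
  assumes "m \<in> factorization_lengths R x" "n \<in> factorization_lengths R x" "x \<notin> Units R"
  shows "ennreal (real m / real n) \<le> elasticity R"
  unfolding elasticity_def element_elasticity_def
  using assms factorization_lengths_closed[OF assms(1)]
  by (intro SUP_upper2[of x] SUP_upper2[of m] SUP_upper2[of n]) auto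

lemma elasticity_leI:
  assumes "\<And>x m n. \<lbrakk>x \<in> carrier R; x \<noteq> \<zero>; x \<notin> Units R; m \<in> factorization_lengths R x;
    n \<in> factorization_lengths R x\<rbrakk> \<Longrightarrow> ennreal (real m / real n) \<le> e"
  shows "elasticity R \<le> e"
  unfolding elasticity_def element_elasticity_def
  using assms by (intro SUP_least) auto

end

text \<open>As \<open>x / 0 = 0\<close>, the last two hypotheses have to exclude a nonzero numerator
  over a zero denominator.\<close>

lemma ennreal_mediant_le:
  fixes s t p q :: nat
  assumes "ennreal (real s / real t) \<le> r" "ennreal (real p / real q) \<le> r"
    and "t = 0 \<Longrightarrow> s = 0" "q = 0 \<Longrightarrow> p = 0"
  shows "ennreal (real (s + p) / real (t + q)) \<le> r"
proof (cases r)
  case (real c)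
  \<comment> \<open>Without denominators both bounds are linear and can be added. They also hold
    when a denominator is zero, since the numerator then vanishes too.\<close>
  have "real s \<le> c * real t" "real p \<le> c * real q"
    using assms real by (auto simp: ennreal_le_iff divide_le_eq split: if_splits)
  then have "real (s + p) \<le> c * real (t + q)"
    by (simp add: algebra_simps)
  then have "real (s + p) / real (t + q) \<le> c"
    using real by (auto simp: divide_le_eq)
  then show ?thesis
    using real by (simp add: ennreal_leI)
qed simp

subsection \<open>Orders whose conductor is a power of a principal prime\<close>

text \<open>\<open>S\<close> stands for the ring of integers; the number field no longer appears.
  \<open>conductor_subset\<close> and \<open>inter_subset\<close> express through multiples of
  \<open>p [^] a\<close> that the ideal generated by this power lies in \<open>R\<close> and
  contains \<open>R \<inter> PIdl p\<close>.\<close>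

locale prime_power_conductor = domain S for S (structure) +
  fixes R :: "'a set" and p :: 'a and a :: nat
  assumes subring: "subring R S"
    and finite_index: "finite (a_rcosets R)"
    and p_closed: "p \<in> carrier S"
    and p_prime: "ring_prime p"
    and a_ge_2: "2 \<le> a"
    and conductor_subset: "x \<in> carrier S \<Longrightarrow> p [^] a \<otimes> x \<in> R"
    and inter_subset: "x \<in> R \<Longrightarrow> p divides x \<Longrightarrow> p [^] a divides x"
    and locally_associated:
      "x \<in> carrier S \<Longrightarrow> PIdl x <+> PIdl (p [^] a) = carrier S \<Longrightarrow> \<exists>u \<in> Units S. u \<otimes> x \<in> R"
begin

abbreviation T where "T \<equiv> S\<lparr>carrier := R\<rparr>"

lemma R_closed [simp]: "x \<in> R \<Longrightarrow> x \<in> carrier S"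
  using subringE(1)[OF subring] by auto

lemma domain_T: "domain T"
  using subring_is_domain[OF subring] .

lemma R_pow: "x \<in> R \<Longrightarrow> x [^] (n::nat) \<in> R"
  by (induction n) (auto simp: subringE(3,6)[OF subring])

section \<open>Divisibility by \<open>p\<close> and associates in \<open>R\<close>\<close>

lemma p_nonzero: "p \<noteq> \<zero>" and p_nonunit: "p \<notin> Units S"
  using ring_primeE(1,3)[OF p_closed p_prime] by (auto simp: prime_def)

lemma p_pow: "p [^] (k::nat) \<in> carrier S" "p [^] (k::nat) \<noteq> \<zero>"
  using p_closed p_nonzero by (induction k) (auto simp: integral_iff)

lemma p_dvd_mult:
  assumes "x \<in> carrier S" "y \<in> carrier S"
  shows "p divides (x \<otimes> y) \<longleftrightarrow> p divides x \<or> p divides y"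
proof
  assume "p divides (x \<otimes> y)"
  then show "p divides x \<or> p divides y"
    using ring_primeE(3)[OF p_closed p_prime] assms by (auto simp: prime_def)
next
  assume "p divides x \<or> p divides y"
  then show "p divides (x \<otimes> y)"
  proof
    assume "p divides x"
    then show ?thesis
      using assms divides_prod_r p_closed by blast
  next
    assume "p divides y"
    then show ?thesis
      using assms divides_prod_l p_closed by blast
  qed
qed

lemma p_dvd_unit: "u \<in> Units S \<Longrightarrow> \<not> p divides u"
  using p_closed p_nonunit divides_unit[of p u] by auto

lemma p_dvd_unit_mult:
  "u \<in> Units S \<Longrightarrow> x \<in> carrier S \<Longrightarrow> p divides (u \<otimes> x) \<longleftrightarrow> p divides x"
  using p_dvd_mult p_dvd_unit by blast

lemma p_dvd_pow_mult:
  assumes "0 < k" "x \<in> carrier S"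
  shows "p divides (p [^] (k::nat) \<otimes> x)"
proof -
  obtain m where "k = Suc m"
    using assms(1) by (cases k) auto
  then show ?thesis
    using assms(2) p_closed p_dvd_mult[of "p [^] k" x] p_dvd_mult[of "p [^] m" p] by simp
qed

text \<open>Multiplication by \<open>p\<close> embeds the residue ring modulo \<open>p\<close> into the finite group \<open>S / R\<close>,
  because \<open>R\<close> meets \<open>p S\<close> inside \<open>p\<^sup>2 S\<close>. Hence that ring is a finite domain.\<close>

lemma unit_mod_p:
  assumes x: "x \<in> carrier S" and ndvd: "\<not> p divides x"
  shows "\<exists>n. 0 < n \<and> p divides (\<one> \<ominus> x [^] (n::nat))"
proof -
  \<comment> \<open>The pigeonhole principle is applied to \<open>p \<otimes> x [^] n\<close>
    instead of \<open>x [^] n\<close>: the difference is then a multiple of \<open>p\<close> in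
    \<open>R\<close>, hence of \<open>p [^] a\<close>, and after one \<open>p\<close> is cancelled
    another one is left since \<open>a \<ge> 2\<close>.\<close>
  obtain i j :: nat where ij: "i < j" "p \<otimes> x [^] j \<ominus> p \<otimes> x [^] i \<in> R"
    using finite_index_pigeonhole[OF subring finite_index, of "\<lambda>n. p \<otimes> x [^] n"] x p_closed
    by auto
  define d where "d = \<one> \<ominus> x [^] (j - i)"
  have d: "d \<in> carrier S"
    using x by (simp add: d_def)
  have "p \<otimes> x [^] j \<ominus> p \<otimes> x [^] i = p \<otimes> (x [^] j \<ominus> x [^] i)"
    using x p_closed by (simp add: minus_eq r_distr r_minus)
  also have "\<dots> = p \<otimes> (\<ominus> (x [^] i \<otimes> d))"
    unfolding nat_pow_diff_split[OF x ij(1)] d_def ..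
  finally have R: "p \<otimes> (\<ominus> (x [^] i \<otimes> d)) \<in> R"
    using ij(2) by simp
  then have "p [^] a divides (p \<otimes> (\<ominus> (x [^] i \<otimes> d)))"
    using inter_subset x d p_closed by blast
  then obtain y where y: "y \<in> carrier S" "p \<otimes> (\<ominus> (x [^] i \<otimes> d)) = p [^] a \<otimes> y"
    by (auto simp: factor_def)
  obtain b where b: "a = Suc (Suc b)"
    using a_ge_2 by (intro that[of "a - 2"]) simp
  have "p [^] a \<otimes> y = p \<otimes> (p \<otimes> (p [^] b \<otimes> y))"
    unfolding b nat_pow_Suc using y(1) p_closed p_pow(1)[of b] by algebra
  then have "\<ominus> (x [^] i \<otimes> d) = p \<otimes> (p [^] b \<otimes> y)"
    using y p_closed p_nonzero x d m_lcancel[of p] by (metis a_inv_closed m_closed nat_pow_closed)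
  then have "x [^] i \<otimes> d = p \<otimes> (\<ominus> (p [^] b \<otimes> y))"
    using y(1) p_closed x d by (metis minus_minus m_closed nat_pow_closed r_minus)
  then have "p divides (x [^] i \<otimes> d)"
    using y(1) p_closed by (auto simp: factor_def)
  moreover have "\<not> p divides (x [^] i)" for i :: nat
    using x ndvd p_dvd_mult p_dvd_unit[of \<one>] by (induction i) auto
  ultimately have "p divides d"
    using p_dvd_mult x d by blast
  then show ?thesis
    using ij(1) d_def by (intro exI[of _ "j - i"]) auto
qed

text \<open>By \<open>unit_mod_p\<close> the element \<open>x\<close> is invertible modulo
  \<open>p\<close>. Raising \<open>\<one> \<ominus> x [^] n = p \<otimes> t\<close> to the power
  \<open>a\<close> makes it invertible modulo \<open>p [^] a\<close>, so \<open>x\<close> is coprime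
  to the conductor and \<open>locally_associated\<close> applies.\<close>

lemma associated_in_R:
  assumes x: "x \<in> carrier S" and ndvd: "\<not> p divides x"
  shows "\<exists>u \<in> Units S. u \<otimes> x \<in> R"
proof -
  obtain n t where n: "0 < n" "t \<in> carrier S" "\<one> \<ominus> x [^] (n::nat) = p \<otimes> t"
    using unit_mod_p[OF assms] by (auto simp: factor_def)
  obtain m where m: "n = Suc m"
    using n(1) by (cases n) auto
  \<comment> \<open>The elements of the form \<open>\<one> \<ominus> w \<otimes> x\<close> are
    closed under multiplication.\<close>
  have pow: "\<exists>w \<in> carrier S. (p \<otimes> t) [^] (k::nat) = \<one> \<ominus> w \<otimes> x" for k
  proof (induction k)
    case 0
    then show ?case
      using x by (intro bexI[of _ \<zero>]) (auto simp: minus_eq)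
  next
    case (Suc k)
    then obtain w where w: "w \<in> carrier S" "(p \<otimes> t) [^] k = \<one> \<ominus> w \<otimes> x"
      by blast
    have xm: "x [^] m \<in> carrier S"
      using x by simp
    have "(p \<otimes> t) [^] Suc k = (\<one> \<ominus> w \<otimes> x) \<otimes> (\<one> \<ominus> x [^] m \<otimes> x)"
      using w n(3) m by simp
    also have "\<dots> = \<one> \<ominus> (w \<oplus> x [^] m \<ominus> w \<otimes> x \<otimes> x [^] m) \<otimes> x"
      using w(1) xm x by algebra
    finally show ?case
      using w xm x by (intro bexI[of _ "w \<oplus> x [^] m \<ominus> w \<otimes> x \<otimes> x [^] m"]) auto
  qed
  obtain w where w: "w \<in> carrier S" "(p \<otimes> t) [^] a = \<one> \<ominus> w \<otimes> x"
    using pow by blast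
  have q: "p [^] a \<in> carrier S" "t [^] a \<in> carrier S" "(p \<otimes> t) [^] a = t [^] a \<otimes> p [^] a"
    using p_closed n(2) by (auto simp: nat_pow_distrib m_comm)
  have "PIdl x <+> PIdl (p [^] a) = carrier S"
  proof
    show "PIdl x <+> PIdl (p [^] a) \<subseteq> carrier S"
      using x q(1) by (auto simp: set_add_def' cgenideal_def)
    show "carrier S \<subseteq> PIdl x <+> PIdl (p [^] a)"
    proof
      fix z assume z: "z \<in> carrier S"
      have "z = z \<otimes> (w \<otimes> x \<oplus> (\<one> \<ominus> w \<otimes> x))"
        using z w(1) x by algebra
      also have "\<dots> = z \<otimes> (w \<otimes> x \<oplus> t [^] a \<otimes> p [^] a)"
        unfolding w(2)[symmetric] q(3) ..
      also have "\<dots> = z \<otimes> w \<otimes> x \<oplus> z \<otimes> t [^] a \<otimes> p [^] a"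
        using z w(1) x q(1,2) by algebra
      finally have "z = z \<otimes> w \<otimes> x \<oplus> z \<otimes> t [^] a \<otimes> p [^] a" .
      moreover have "z \<otimes> w \<otimes> x \<in> PIdl x" "z \<otimes> t [^] a \<otimes> p [^] a \<in> PIdl (p [^] a)"
        using z w(1) q(2) by (auto simp: cgenideal_def)
      ultimately show "z \<in> PIdl x <+> PIdl (p [^] a)"
        unfolding set_add_def' by blast
    qed
  qed
  then show ?thesis
    by (rule locally_associated[OF x])
qed

text \<open>A power \<open>x [^] m\<close>, itself in \<open>R\<close>, inverts \<open>x\<close>
  modulo the conductor: \<open>\<one> \<ominus> x [^] m \<otimes> x\<close> lies in \<open>R\<close>
  and is divisible by \<open>p\<close>, hence by \<open>p [^] a\<close>. So \<open>y\<close> differs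
  from \<open>x [^] m \<otimes> (x \<otimes> y)\<close> by an element of the conductor.\<close>

lemma mult_mem_imp_mem:
  assumes x: "x \<in> R" "\<not> p divides x" and y: "y \<in> carrier S" "x \<otimes> y \<in> R"
  shows "y \<in> R"
proof -
  obtain n where n: "0 < n" "p divides (\<one> \<ominus> x [^] (n::nat))"
    using unit_mod_p[OF R_closed] x by blast
  obtain m where m: "n = Suc m"
    using n(1) by (cases n) auto
  have xm: "x [^] m \<in> R"
    using x(1) R_pow by blast
  have "\<one> \<ominus> x [^] n \<in> R"
    unfolding minus_eq using R_pow[OF x(1)] subringE(3,5,7)[OF subring] by blast
  then obtain z where z: "z \<in> carrier S" "\<one> \<ominus> x [^] n = p [^] a \<otimes> z"
    using inter_subset n(2) by (auto simp: factor_def)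
  have "y = x [^] m \<otimes> (x \<otimes> y) \<oplus> (\<one> \<ominus> x [^] m \<otimes> x) \<otimes> y"
    using y(1) R_closed[OF x(1)] R_closed[OF xm] by algebra
  also have "(\<one> \<ominus> x [^] m \<otimes> x) \<otimes> y = p [^] a \<otimes> (z \<otimes> y)"
    using z m y(1) p_closed by (simp add: m_assoc)
  finally show ?thesis
    using conductor_subset[of "z \<otimes> y"] xm y z(1) subringE(6,7)[OF subring] by (metis m_closed)
qed

section \<open>Units and irreducible elements of \<open>T\<close>\<close>

text \<open>The inverse of a unit lies in \<open>R\<close> by \<open>mult_mem_imp_mem\<close>,
  because its product with \<open>x\<close> is \<open>\<one>\<close>.\<close>

lemma Units_T: "x \<in> Units T \<longleftrightarrow> x \<in> R \<and> x \<in> Units S"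
proof
  assume "x \<in> Units T"
  then show "x \<in> R \<and> x \<in> Units S"
    by (auto simp: Units_def)
next
  assume x: "x \<in> R \<and> x \<in> Units S"
  then have "inv x \<in> R"
    using mult_mem_imp_mem[of x "inv x"] p_dvd_unit subringE(3)[OF subring] by auto
  then show "x \<in> Units T"
    using x Units_r_inv[of x] Units_l_inv[of x] unfolding Units_def[of T]
    by (auto simp del: Units_r_inv Units_l_inv)
qed

text \<open>A factorization \<open>b \<otimes> c\<close> in \<open>S\<close> can be moved into
  \<open>R\<close>: some \<open>u \<otimes> b\<close> lies in \<open>R\<close> by
  \<open>associated_in_R\<close>, and \<open>inv u \<otimes> c\<close> follows by
  \<open>mult_mem_imp_mem\<close>.\<close>

lemma irreducible_T_iff:
  assumes "x \<in> R" "\<not> p divides x"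
  shows "ring_irreducible\<^bsub>T\<^esub> x \<longleftrightarrow> ring_irreducible\<^bsub>S\<^esub> x"
proof
  assume irr: "ring_irreducible\<^bsub>T\<^esub> x"
  show "ring_irreducible\<^bsub>S\<^esub> x"
  proof (rule ring_irreducibleI)
    show "x \<in> carrier S - {\<zero>}" "x \<notin> Units S"
      using domain.ring_irreducibleE(1,4)[OF domain_T _ irr] assms(1) by (auto simp: Units_T)
    fix b c assume bc: "b \<in> carrier S" "c \<in> carrier S" "x = b \<otimes> c"
    then have ndvd: "\<not> p divides b"
      using assms p_dvd_mult by blast
    then obtain u where u: "u \<in> Units S" "u \<otimes> b \<in> R"
      using associated_in_R bc(1) by blast
    have x: "x = (u \<otimes> b) \<otimes> (inv u \<otimes> c)"
      using Units_inv_mult_cancel(1)[OF u(1)] bc by simp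
    then have "inv u \<otimes> c \<in> R"
      using mult_mem_imp_mem[of "u \<otimes> b" "inv u \<otimes> c"] assms u ndvd bc by (auto simp: p_dvd_unit_mult)
    then have "u \<otimes> b \<in> Units S \<or> inv u \<otimes> c \<in> Units S"
      using domain.ring_irreducibleE(5)[OF domain_T _ irr, of "u \<otimes> b" "inv u \<otimes> c"] assms(1) u x
      by (auto simp: Units_T)
    then show "b \<in> Units S \<or> c \<in> Units S"
      using u(1) bc Units_of_mult(2) by blast
  qed
next
  assume irr: "ring_irreducible\<^bsub>S\<^esub> x"
  show "ring_irreducible\<^bsub>T\<^esub> x"
  proof (rule domain.ring_irreducibleI[OF domain_T])
    show "x \<in> carrier T - {\<zero>\<^bsub>T\<^esub>}" "x \<notin> Units T"
      using ring_irreducibleE(1,4)[OF _ irr] assms(1) by (auto simp: Units_T)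
    fix b c assume "b \<in> carrier T" "c \<in> carrier T" "x = b \<otimes>\<^bsub>T\<^esub> c"
    then show "b \<in> Units T \<or> c \<in> Units T"
      using ring_irreducibleE(5)[OF _ irr, of b c] assms(1) by (auto simp: Units_T)
  qed
qed

lemma p_pow_split:
  assumes "x \<in> carrier S"
  shows "(\<exists>i<n. \<exists>y \<in> carrier S. \<not> p divides y \<and> x = p [^] (i::nat) \<otimes> y) \<or>
         (\<exists>y \<in> carrier S. x = p [^] (n::nat) \<otimes> y)"
proof (induction n)
  case 0
  then show ?case using assms by auto
next
  case (Suc n)
  then consider "\<exists>i<n. \<exists>y \<in> carrier S. \<not> p divides y \<and> x = p [^] i \<otimes> y"
    | y where "y \<in> carrier S" "x = p [^] n \<otimes> y"
    by blast
  then show ?case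
  proof cases
    case 1
    then show ?thesis by (meson less_Suc_eq)
  next
    case 2
    show ?thesis
    proof (cases "p divides y")
      case True
      then obtain z where "z \<in> carrier S" "y = p \<otimes> z"
        by (auto simp: factor_def)
      then show ?thesis
        using 2 p_closed by (auto simp: m_assoc)
    next
      case False
      then show ?thesis using 2 by blast
    qed
  qed
qed

text \<open>Ensures that two factorizations of the same element lead to the same exponent
  \<open>k\<close> and the same cofactor \<open>y\<close>.\<close>

lemma p_pow_factor_unique:
  assumes "y \<in> carrier S" "z \<in> carrier S" "\<not> p divides y" "\<not> p divides z"
    and eq: "p [^] (i::nat) \<otimes> y = p [^] (j::nat) \<otimes> z"
  shows "i = j" "y = z"
proof -
  have le: "j \<le> i" if yz: "y \<in> carrier S" "z \<in> carrier S" "\<not> p divides y"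
    and eq: "p [^] i \<otimes> y = p [^] j \<otimes> z" for y z and i j :: nat
  proof (rule ccontr)
    assume "\<not> j \<le> i"
    then have "p [^] j = p [^] i \<otimes> p [^] (j - i)"
      using p_closed by (simp add: nat_pow_mult)
    then have "p [^] i \<otimes> y = p [^] i \<otimes> (p [^] (j - i) \<otimes> z)"
      using eq yz p_pow(1) by (simp add: m_assoc)
    then have "y = p [^] (j - i) \<otimes> z"
      using m_lcancel[OF p_pow(2,1)] yz p_pow(1) by simp
    then show False
      using p_dvd_pow_mult[of "j - i" z] yz \<open>\<not> j \<le> i\<close> by simp
  qed
  show "i = j"
    using le[of y z i j] le[of z y j i] assms by auto
  then show "y = z"
    using eq m_lcancel[OF p_pow(2,1)] assms by simp
qed

text \<open>Write \<open>x\<close> as \<open>p [^] a \<otimes> d\<close>. If \<open>p [^] a\<close>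
  divides \<open>d\<close>, then \<open>x\<close> is a product of two nonunits of \<open>T\<close>.
  Otherwise \<open>d = p [^] i \<otimes> y\<close> with \<open>i < a\<close>, and an associate of
  \<open>y\<close> in \<open>R\<close> splits off, so it must be a unit.\<close>

lemma irreducible_T_p_dvd:
  assumes x: "x \<in> R" "p divides x" and irr: "ring_irreducible\<^bsub>T\<^esub> x"
  shows "\<exists>k. \<exists>u \<in> Units S. a \<le> k \<and> k \<le> 2 * a - 1 \<and> x = p [^] (k::nat) \<otimes> u"
proof -
  obtain d where d: "d \<in> carrier S" "x = p [^] a \<otimes> d"
    using inter_subset[OF x] by (auto simp: factor_def)
  have nonunit: "p [^] a \<otimes> y \<notin> Units T" if "y \<in> carrier S" for y
    using p_dvd_unit p_dvd_pow_mult[of a y] that a_ge_2 by (auto simp: Units_T)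
  from p_pow_split[OF d(1), of a] consider
    i y where "i < a" "y \<in> carrier S" "\<not> p divides y" "d = p [^] i \<otimes> y"
    | y where "y \<in> carrier S" "d = p [^] a \<otimes> y"
    by blast
  then show ?thesis
  proof cases
    case 1
    obtain u where u: "u \<in> Units S" "u \<otimes> y \<in> R"
      using associated_in_R 1(2,3) by blast
    \<comment> \<open>The inverse of \<open>u\<close> is placed beside the power of
      \<open>p\<close>, where the conductor absorbs it.\<close>
    define z where "z = p [^] a \<otimes> (inv u \<otimes> p [^] i)"
    have carr: "inv u \<in> carrier S" "inv u \<otimes> p [^] i \<in> carrier S"
      using u(1) p_pow(1) by auto
    have "x = p [^] a \<otimes> ((u \<otimes> y) \<otimes> (inv u \<otimes> p [^] i))"
      using d(2) 1(2,4) Units_inv_mult_cancel(1)[OF u(1) 1(2) p_pow(1)[of i]] m_comm p_pow(1) by simp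
    then have "x = (u \<otimes> y) \<otimes> z"
      unfolding z_def using carr u p_pow(1)[of a] m_lcomm R_closed by metis
    moreover have "z \<in> R" "z \<notin> Units T"
      unfolding z_def using carr conductor_subset nonunit by auto
    ultimately have "u \<otimes> y \<in> Units S"
      using domain.ring_irreducibleE(5)[OF domain_T _ irr, of "u \<otimes> y" z] x(1) u by (auto simp: Units_T)
    then have "y \<in> Units S"
      using Units_of_mult(2) u(1) 1(2) by blast
    moreover have "x = p [^] (a + i) \<otimes> y"
      using d(2) 1(2,4) p_closed by (simp add: m_assoc[symmetric] nat_pow_mult)
    ultimately show ?thesis
      using 1(1) by (intro exI[of _ "a + i"]) auto
  next
    case 2
    have "p [^] a \<in> R" "p [^] a \<notin> Units T" "d \<in> R" "d \<notin> Units T"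
      using conductor_subset[of \<one>] nonunit[of \<one>] conductor_subset[of y] nonunit[of y] 2 p_pow(1) by auto
    then show ?thesis
      using domain.ring_irreducibleE(5)[OF domain_T _ irr, of "p [^] a" d] x(1) d(2) by auto
  qed
qed

text \<open>One of two factors in \<open>R\<close> is divisible by \<open>p\<close>, hence by
  \<open>p [^] a\<close>, and leaves only a unit for the other.\<close>

lemma irreducible_T_p_pow: "ring_irreducible\<^bsub>T\<^esub> (p [^] a)"
proof (rule domain.ring_irreducibleI[OF domain_T])
  have dvd: "p divides (p [^] a)"
    using p_dvd_pow_mult[of a \<one>] a_ge_2 p_pow(1) by simp
  show "p [^] a \<in> carrier T - {\<zero>\<^bsub>T\<^esub>}" "p [^] a \<notin> Units T"
    using conductor_subset[of \<one>] p_pow dvd p_dvd_unit by (auto simp: Units_T)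
  fix b c assume "b \<in> carrier T" "c \<in> carrier T" "p [^] a = b \<otimes>\<^bsub>T\<^esub> c"
  then have bc: "b \<in> R" "c \<in> R" "p [^] a = b \<otimes> c"
    by auto
  have unit: "b \<in> Units T" if bc: "b \<in> R" "c \<in> R" "p [^] a = b \<otimes> c" "p divides c" for b c
  proof -
    obtain d where d: "d \<in> carrier S" "c = p [^] a \<otimes> d"
      using inter_subset bc by (auto simp: factor_def)
    have "p [^] a \<otimes> \<one> = p [^] a \<otimes> (b \<otimes> d)"
      using bc(3) d p_pow(1) R_closed[OF bc(1)] by (simp add: m_lcomm)
    then have "b \<otimes> d = \<one>"
      using m_lcancel[OF p_pow(2,1)] d bc by (metis R_closed m_closed one_closed)
    then show ?thesis
      using Units_of_mult(1)[of b d] d bc by (simp add: Units_T)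
  qed
  show "b \<in> Units T \<or> c \<in> Units T"
    using unit[of b c] unit[of c b] bc dvd p_dvd_mult[of b c] m_comm by auto
qed

section \<open>Factorization lengths in \<open>S\<close> and in \<open>T\<close>\<close>

text \<open>An irreducible factor divisible by \<open>p\<close> is \<open>p\<close> times a unit,
  and \<open>k\<close> counts these factors. The \<open>q\<close> others have product
  \<open>u \<otimes> y\<close>, where \<open>u\<close> is the inverse of the product of the units
  split off.\<close>

lemma lengths_S_decomp:
  assumes "n \<in> factorization_lengths S x"
  shows "\<exists>k q. \<exists>y \<in> carrier S. \<exists>u \<in> Units S. \<not> p divides y \<and> x = p [^] (k::nat) \<otimes> y \<and> n = k + q \<and>
           q \<in> factorization_lengths S (u \<otimes> y)"
  using assms
proof (induction n arbitrary: x)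
  case 0
  then have "x = p [^] (0::nat) \<otimes> \<one>" "0 \<in> factorization_lengths S (\<one> \<otimes> \<one>)" "\<not> p divides \<one>"
    using p_dvd_unit by (auto simp: factorization_lengths_0)
  then show ?case
    using Units_one_closed one_closed by (metis add_0)
next
  case (Suc n)
  then obtain b c where bc: "b \<in> carrier S" "ring_irreducible b" "n \<in> factorization_lengths S c" "x = b \<otimes> c"
    by (auto simp: factorization_lengths_Suc)
  from Suc.IH[OF bc(3)] obtain k q y u where IH: "y \<in> carrier S" "u \<in> Units S" "\<not> p divides y"
      "c = p [^] (k::nat) \<otimes> y" "n = k + q" "q \<in> factorization_lengths S (u \<otimes> y)"
    by blast
  note carr = IH(1) bc(1) p_closed p_pow(1)[of k] Units_closed[OF IH(2)]
  show ?case
  proof (cases "p divides b")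
    case True
    then obtain d where d: "d \<in> carrier S" "b = p \<otimes> d"
      by (auto simp: factor_def)
    then have unit: "d \<in> Units S"
      using ring_irreducibleE(5)[OF bc(1,2) p_closed d] p_nonunit by blast
    have "x = p [^] Suc k \<otimes> (d \<otimes> y)"
      unfolding bc(4) IH(4) d(2) nat_pow_Suc using carr d(1) by algebra
    moreover have "(u \<otimes> inv d) \<otimes> (d \<otimes> y) = u \<otimes> y"
      using Units_inv_mult_cancel(2)[OF unit] carr by simp
    then have "q \<in> factorization_lengths S ((u \<otimes> inv d) \<otimes> (d \<otimes> y))"
      using IH(6) by simp
    moreover have "\<not> p divides (d \<otimes> y)" "d \<otimes> y \<in> carrier S" "u \<otimes> inv d \<in> Units S" "Suc n = Suc k + q"
      using unit carr IH(2,3,5) p_dvd_unit_mult by auto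
    ultimately show ?thesis
      by blast
  next
    case False
    have "x = p [^] k \<otimes> (b \<otimes> y)" "b \<otimes> (u \<otimes> y) = u \<otimes> (b \<otimes> y)"
      unfolding bc(4) IH(4) using carr by algebra+
    moreover have "Suc q \<in> factorization_lengths S (b \<otimes> (u \<otimes> y))"
      unfolding factorization_lengths_Suc using bc(1,2) IH(6) by blast
    moreover have "\<not> p divides (b \<otimes> y)" "b \<otimes> y \<in> carrier S" "Suc n = k + Suc q"
      using carr IH(3,5) False p_dvd_mult by auto
    ultimately show ?thesis
      using IH(2) by metis
  qed
qed

text \<open>Here \<open>s\<close> counts the factors divisible by \<open>p\<close>, each of which
  contributes between \<open>a\<close> and \<open>2 * a - 1\<close> to the exponent
  \<open>k\<close>. The \<open>q\<close> other factors are irreducible in \<open>S\<close> as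
  well.\<close>

lemma lengths_T_decomp:
  assumes "n \<in> factorization_lengths T x"
  shows "\<exists>k s q. \<exists>y \<in> carrier S. \<exists>u \<in> Units S. \<not> p divides y \<and> x = p [^] (k::nat) \<otimes> y \<and> n = s + q \<and>
           s * a \<le> k \<and> k \<le> s * (2 * a - 1) \<and> q \<in> factorization_lengths S (u \<otimes> y)"
  using assms
proof (induction n arbitrary: x)
  case 0
  then have "x = p [^] (0::nat) \<otimes> \<one>" "0 \<in> factorization_lengths S (\<one> \<otimes> \<one>)" "\<not> p divides \<one>"
    using p_dvd_unit domain.factorization_lengths_0[OF domain_T] by (auto simp: factorization_lengths_0)
  moreover have "(0::nat) = 0 + 0" "0 * a \<le> (0::nat)" "(0::nat) \<le> 0 * (2 * a - 1)"
    by auto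
  ultimately show ?case
    using Units_one_closed one_closed by metis
next
  case (Suc n)
  then obtain b c where bc: "b \<in> R" "ring_irreducible\<^bsub>T\<^esub> b" "n \<in> factorization_lengths T c" "x = b \<otimes> c"
    by (auto simp: domain.factorization_lengths_Suc[OF domain_T])
  from Suc.IH[OF bc(3)] obtain k s q y u where IH: "y \<in> carrier S" "u \<in> Units S" "\<not> p divides y"
      "c = p [^] (k::nat) \<otimes> y" "n = s + q" "s * a \<le> k" "k \<le> s * (2 * a - 1)"
      "q \<in> factorization_lengths S (u \<otimes> y)"
    by blast
  note carr = IH(1) R_closed[OF bc(1)] p_closed p_pow(1)[of k] Units_closed[OF IH(2)]
  show ?case
  proof (cases "p divides b")
    case True
    then obtain j d where d: "d \<in> Units S" "a \<le> j" "j \<le> 2 * a - 1" "b = p [^] (j::nat) \<otimes> d"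
      using irreducible_T_p_dvd[OF bc(1) _ bc(2)] by blast
    have "x = (p [^] j \<otimes> p [^] k) \<otimes> (d \<otimes> y)"
      unfolding bc(4) IH(4) d(4) using carr p_pow(1)[of j] Units_closed[OF d(1)] by algebra
    then have "x = p [^] (j + k) \<otimes> (d \<otimes> y)"
      using p_closed by (simp add: nat_pow_mult)
    moreover have "(u \<otimes> inv d) \<otimes> (d \<otimes> y) = u \<otimes> y"
      using Units_inv_mult_cancel(2)[OF d(1)] carr by simp
    then have "q \<in> factorization_lengths S ((u \<otimes> inv d) \<otimes> (d \<otimes> y))"
      using IH(8) by simp
    moreover have "\<not> p divides (d \<otimes> y)" "d \<otimes> y \<in> carrier S" "u \<otimes> inv d \<in> Units S" "Suc n = Suc s + q"
        "Suc s * a \<le> j + k" "j + k \<le> Suc s * (2 * a - 1)"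
      using d carr IH(2,3,5-7) p_dvd_unit_mult by auto
    ultimately show ?thesis
      by blast
  next
    case False
    have "x = p [^] k \<otimes> (b \<otimes> y)" "b \<otimes> (u \<otimes> y) = u \<otimes> (b \<otimes> y)"
      unfolding bc(4) IH(4) using carr by algebra+
    moreover have "Suc q \<in> factorization_lengths S (b \<otimes> (u \<otimes> y))"
      unfolding factorization_lengths_Suc
      using carr(2) bc(2) IH(8) irreducible_T_iff[OF bc(1) False] by blast
    moreover have "\<not> p divides (b \<otimes> y)" "b \<otimes> y \<in> carrier S" "Suc n = s + Suc q"
      using carr IH(3,5) False p_dvd_mult by auto
    ultimately show ?thesis
      using IH(2,6,7) by metis
  qed
qed

text \<open>Units are passed along the factorization from each factor to the rest, until all factors
  lie in \<open>R\<close>.\<close>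

lemma lengths_S_subset_T:
  assumes "x \<in> R" "\<not> p divides x" "n \<in> factorization_lengths S x"
  shows "n \<in> factorization_lengths T x"
  using assms
proof (induction n arbitrary: x)
  case 0
  then show ?case
    using domain.factorization_lengths_0[OF domain_T] by (simp add: factorization_lengths_0)
next
  case (Suc n)
  then obtain b c where bc: "b \<in> carrier S" "ring_irreducible b" "n \<in> factorization_lengths S c" "x = b \<otimes> c"
    by (auto simp: factorization_lengths_Suc)
  have c: "c \<in> carrier S"
    using factorization_lengths_closed[OF bc(3)] by blast
  have ndvd: "\<not> p divides b" "\<not> p divides c"
    using Suc.prems(2) bc(1,4) c p_dvd_mult by auto
  have "\<exists>b' c'. b' \<in> R \<and> ring_irreducible b' \<and> \<not> p divides b' \<and> n \<in> factorization_lengths T c' \<and> x = b' \<otimes> c'"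
  proof (cases n)
    \<comment> \<open>No irreducible factor is left to absorb a unit, but the last factor is
      \<open>x\<close> itself and already lies in \<open>R\<close>.\<close>
    case 0
    then have "c = \<one>"
      using bc(3) factorization_lengths_0 by simp
    then have "b = x" "x = x \<otimes> \<one>" "n \<in> factorization_lengths T \<one>"
      using bc(1,4) 0 domain.factorization_lengths_0[OF domain_T] by auto
    then show ?thesis
      using Suc.prems(1,2) bc(2) by blast
  next
    case (Suc m)
    obtain u where u: "u \<in> Units S" "u \<otimes> b \<in> R"
      using associated_in_R bc(1) ndvd(1) by blast
    have x: "x = (u \<otimes> b) \<otimes> (inv u \<otimes> c)"
      using Units_inv_mult_cancel(1)[OF u(1) bc(1) c] bc(4) by simp
    have ndvd': "\<not> p divides (u \<otimes> b)" "\<not> p divides (inv u \<otimes> c)"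
      using u(1) bc(1) c ndvd p_dvd_unit_mult by auto
    then have "inv u \<otimes> c \<in> R"
      using mult_mem_imp_mem[OF u(2), of "inv u \<otimes> c"] u(1) c x Suc.prems(1) by simp
    moreover have "n \<in> factorization_lengths S (inv u \<otimes> c)"
      using factorization_lengths_mult_unit[OF bc(3)] Suc u(1) by simp
    ultimately have "n \<in> factorization_lengths T (inv u \<otimes> c)"
      using Suc.IH ndvd'(2) by blast
    moreover have "ring_irreducible (u \<otimes> b)"
      using ring_irreducible_mult_unit bc(1,2) u(1) by blast
    ultimately show ?thesis
      using u(2) ndvd'(1) x by blast
  qed
  then obtain b' c' where b': "b' \<in> R" "ring_irreducible b'" "\<not> p divides b'"
      "n \<in> factorization_lengths T c'" "x = b' \<otimes> c'"
    by blast
  have "ring_irreducible\<^bsub>T\<^esub> b'"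
    using irreducible_T_iff[OF b'(1,3)] b'(2) by blast
  then have "\<exists>b c. b \<in> carrier T \<and> ring_irreducible\<^bsub>T\<^esub> b \<and> n \<in> factorization_lengths T c \<and> x = b \<otimes>\<^bsub>T\<^esub> c"
    using b' by auto
  then show ?case
    by (simp only: domain.factorization_lengths_Suc[OF domain_T])
qed

section \<open>Comparison of the elasticities\<close>

text \<open>Two factorizations of \<open>x\<close> share \<open>k\<close> and \<open>y\<close>, so
  \<open>m / n\<close> is the mediant of \<open>s / s'\<close> and \<open>q / q'\<close>. The first
  is at most \<open>(2 * a - 1) / a\<close> because
  \<open>s * a \<le> k \<le> s' * (2 * a - 1)\<close>; the second compares lengths of
  \<open>y\<close> in \<open>S\<close>.\<close>

lemma elasticity_T_le:
  assumes "elasticity S \<ge> ennreal ((2 * real a - 1) / real a)"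
  shows "elasticity T \<le> elasticity S"
proof (rule domain.elasticity_leI[OF domain_T])
  fix x m n
  assume mn: "m \<in> factorization_lengths T x" "n \<in> factorization_lengths T x"
  from lengths_T_decomp[OF mn(1)] obtain k y s q u where
    m: "y \<in> carrier S" "u \<in> Units S" "\<not> p divides y" "x = p [^] (k::nat) \<otimes> y" "m = s + q"
      "s * a \<le> k" "k \<le> s * (2 * a - 1)" "q \<in> factorization_lengths S (u \<otimes> y)"
    by blast
  from lengths_T_decomp[OF mn(2)] obtain k' y' s' q' u' where
    n: "y' \<in> carrier S" "u' \<in> Units S" "\<not> p divides y'" "x = p [^] (k'::nat) \<otimes> y'" "n = s' + q'"
      "s' * a \<le> k'" "k' \<le> s' * (2 * a - 1)" "q' \<in> factorization_lengths S (u' \<otimes> y')"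
    by blast
  have eq: "k' = k" "y' = y"
    using p_pow_factor_unique[OF n(1) m(1) n(3) m(3) trans[OF n(4)[symmetric] m(4)]] .
  have sa: "s * a \<le> s' * (2 * a - 1)"
    using m(6) n(7) eq by simp
  have "real (2 * a - 1) = 2 * real a - 1"
    using a_ge_2 by (simp add: of_nat_diff)
  then have "real s * real a \<le> real s' * (2 * real a - 1)"
    using sa by (metis of_nat_le_iff of_nat_mult)
  then have "real s / real s' \<le> (2 * real a - 1) / real a"
    using a_ge_2 by (cases "s' = 0") (auto simp: field_simps)
  then have "ennreal (real s / real s') \<le> elasticity S"
    using assms ennreal_leI order_trans by blast
  \<comment> \<open>For a unit \<open>y\<close> both \<open>q\<close> and \<open>q'\<close> vanish
    and the quotient is 0 by convention; otherwise both are positive lengths of \<open>y\<close> in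
    \<open>S\<close>.\<close>
  moreover have "ennreal (real q / real q') \<le> elasticity S \<and> (q' = 0 \<longrightarrow> q = 0)"
    using factorization_lengths_associated[OF m(8,2,1)] m(1)
      factorization_lengths_associated[OF n(8)[unfolded eq(2)] n(2) m(1)]
    by (cases "y \<in> Units S") (auto intro: factorization_lengths_ratio_le)
  moreover have "s = 0" if "s' = 0"
    using sa a_ge_2 that by simp
  ultimately show "ennreal (real m / real n) \<le> elasticity S"
    unfolding m(5) n(5) by (intro ennreal_mediant_le) auto
qed

text \<open>The irreducible element \<open>p [^] a\<close> has length 1. The bound covers the
  quotient \<open>k / k\<close> in the next lemma.\<close>

lemma one_le_elasticity_T: "1 \<le> elasticity T"
proof -
  have "Suc 0 \<in> factorization_lengths T (p [^] a)"
    unfolding domain.factorization_lengths_Suc[OF domain_T]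
    using irreducible_T_p_pow conductor_subset[of \<one>] p_pow(1)
      domain.factorization_lengths_0[OF domain_T, of \<one>]
    by (intro exI[of _ "p [^] a"] exI[of _ \<one>]) auto
  moreover have "p [^] a \<notin> Units T"
    using domain.ring_irreducibleE(4)[OF domain_T _ irreducible_T_p_pow] conductor_subset[of \<one>] p_pow(1)
    by simp
  ultimately show ?thesis
    using domain.factorization_lengths_ratio_le[OF domain_T, of "Suc 0" "p [^] a" "Suc 0"] by simp
qed

text \<open>The quotient of two lengths is the mediant of \<open>k / k\<close> and
  \<open>q / q'\<close>. For a nonunit \<open>y\<close>, both \<open>q\<close> and \<open>q'\<close>
  are lengths in \<open>T\<close> of an associate of \<open>y\<close> that lies in
  \<open>R\<close>.\<close>

lemma elasticity_S_le: "elasticity S \<le> elasticity T"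
proof (rule elasticity_leI)
  fix x m n
  assume mn: "m \<in> factorization_lengths S x" "n \<in> factorization_lengths S x"
  from lengths_S_decomp[OF mn(1)] obtain k y q u where
    m: "y \<in> carrier S" "u \<in> Units S" "\<not> p divides y" "x = p [^] (k::nat) \<otimes> y" "m = k + q"
      "q \<in> factorization_lengths S (u \<otimes> y)"
    by blast
  from lengths_S_decomp[OF mn(2)] obtain k' y' q' u' where
    n: "y' \<in> carrier S" "u' \<in> Units S" "\<not> p divides y'" "x = p [^] (k'::nat) \<otimes> y'" "n = k' + q'"
      "q' \<in> factorization_lengths S (u' \<otimes> y')"
    by blast
  have eq: "k' = k" "y' = y"
    using p_pow_factor_unique[OF n(1) m(1) n(3) m(3) trans[OF n(4)[symmetric] m(4)]] .
  note q = factorization_lengths_associated[OF m(6,2,1)]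
  note q' = factorization_lengths_associated[OF n(6)[unfolded eq(2)] n(2) m(1)]
  have "ennreal (real q / real q') \<le> elasticity T \<and> (q' = 0 \<longrightarrow> q = 0)"
  proof (cases "y \<in> Units S")
    case True
    then show ?thesis using q(1) by simp
  next
    case False
    obtain v where v: "v \<in> Units S" "v \<otimes> y \<in> R"
      using associated_in_R m(1,3) by blast
    have "q \<in> factorization_lengths T (v \<otimes> y)" "q' \<in> factorization_lengths T (v \<otimes> y)"
      using lengths_S_subset_T[OF v(2)] p_dvd_unit_mult[OF v(1) m(1)] m(3) q(2) q'(2) False v(1)
        factorization_lengths_mult_unit by auto
    moreover have "v \<otimes> y \<notin> Units T"
      using False Units_of_mult(2)[of v y] v(1) m(1) by (auto simp: Units_T)
    ultimately show ?thesis
      using domain.factorization_lengths_ratio_le[OF domain_T] q'(2) False by blast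
  qed
  moreover have "ennreal (real k / real k) \<le> elasticity T"
    using one_le_elasticity_T by (cases "k = 0") auto
  ultimately show "ennreal (real m / real n) \<le> elasticity T"
    unfolding m(5) n(5) eq by (intro ennreal_mediant_le) auto
qed

text \<open>After one \<open>p\<close> is cancelled from
  \<open>u \<otimes> p = p [^] a \<otimes> y\<close>, the unit \<open>u\<close> would still be
  divisible by \<open>p\<close>, because \<open>a \<ge> 2\<close>.\<close>

lemma p_not_associated:
  assumes "u \<in> Units S"
  shows "u \<otimes> p \<notin> R"
proof
  assume "u \<otimes> p \<in> R"
  then have "p [^] a divides (u \<otimes> p)"
    using inter_subset assms p_closed p_dvd_mult[of u p] by auto
  then obtain y where y: "y \<in> carrier S" "u \<otimes> p = p [^] a \<otimes> y"
    by (auto simp: factor_def)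
  obtain b where b: "a = Suc (Suc b)"
    using a_ge_2 by (intro that[of "a - 2"]) simp
  have "p \<otimes> u = p \<otimes> (p [^] Suc b \<otimes> y)"
    using y(2) unfolding b nat_pow_Suc
    using y(1) p_closed p_pow(1)[of b] Units_closed[OF assms] by algebra
  then have "u = p [^] Suc b \<otimes> y"
    using m_lcancel[OF p_nonzero p_closed Units_closed[OF assms]] y(1) p_pow(1) by (metis m_closed)
  then show False
    using p_dvd_unit[OF assms] p_dvd_pow_mult[of "Suc b" y] y(1) by simp
qed

end

subsection \<open>Orders in number fields\<close>

theorem proposition4p3:
  fixes K :: "('a, 'b) ring_scheme" and R P :: "'a set" and \<pi> :: 'a and a :: nat
  assumes "number_field K"
    and "order_in K R"
    and "locally_associated_order K R"
    and "\<pi> \<in> integers_of K"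
    and "P = PIdl\<^bsub>ring_of_integers K\<^esub> \<pi>"
    and "primeideal P (ring_of_integers K)"
    and "a \<ge> 2"
    and "conductor K R = P [^]\<^bsub>ideals_set (ring_of_integers K)\<^esub> a"
    and "R \<inter> P = conductor K R"
    and "elasticity (ring_of_integers K) \<ge> ennreal ((2 * real a - 1) / real a)"
  shows "elasticity (K\<lparr>carrier := R\<rparr>) = elasticity (ring_of_integers K)
         \<and> \<not> associated_order K R"
proof -
  interpret K: number_field K by fact
  let ?O = "ring_of_integers K"
  have O_simps: "carrier ?O = integers_of K" "(\<otimes>\<^bsub>?O\<^esub>) = (\<otimes>\<^bsub>K\<^esub>)"
      "\<one>\<^bsub>?O\<^esub> = \<one>\<^bsub>K\<^esub>" "\<zero>\<^bsub>?O\<^esub> = \<zero>\<^bsub>K\<^esub>" "(\<oplus>\<^bsub>?O\<^esub>) = (\<oplus>\<^bsub>K\<^esub>)"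
    by (simp_all add: ring_of_integers_def)
  have sub: "integers_of K \<subseteq> carrier K"
    by (auto simp: integers_of_def)
  interpret O: domain ?O
  proof (intro domain.intro domain_axioms.intro)
    \<comment> \<open>The axioms of a commutative ring are part of the locale
      \<open>primeideal\<close>.\<close>
    show "cring ?O"
      using assms(6) by (simp add: primeideal_def)
    show "\<one>\<^bsub>?O\<^esub> \<noteq> \<zero>\<^bsub>?O\<^esub>"
      by (simp add: O_simps)
    show "x = \<zero>\<^bsub>?O\<^esub> \<or> y = \<zero>\<^bsub>?O\<^esub>"
      if "x \<otimes>\<^bsub>?O\<^esub> y = \<zero>\<^bsub>?O\<^esub>" "x \<in> carrier ?O" "y \<in> carrier ?O" for x y
      using that K.integral sub unfolding O_simps by blast
  qed
  have R: "subring R ?O" "finite (a_rcosets\<^bsub>?O\<^esub> R)"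
    using assms(2) by (auto simp: order_in_def)
  have pi: "\<pi> \<in> carrier ?O"
    using assms(4) by (simp add: O_simps)
  have cond: "conductor K R = PIdl\<^bsub>?O\<^esub> (\<pi> [^]\<^bsub>?O\<^esub> a)"
    using assms(5,8) O.cgenideal_nat_pow[OF pi] by simp
  \<comment> \<open>\<open>primeideal\<close> admits the zero ideal. For \<open>\<pi>\<close> zero
    the conductor would vanish, but it contains the image of \<open>N\<close>, the factorial of the
    index, which is nonzero in characteristic zero.\<close>
  have "\<pi> \<noteq> \<zero>\<^bsub>?O\<^esub>"
  proof
    assume "\<pi> = \<zero>\<^bsub>?O\<^esub>"
    obtain b where "a = Suc b"
      using assms(7) by (cases a) auto
    then have "\<pi> [^]\<^bsub>?O\<^esub> a = \<zero>\<^bsub>?O\<^esub>"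
      using \<open>\<pi> = \<zero>\<^bsub>?O\<^esub>\<close> by simp
    then have zero: "x = \<zero>\<^bsub>?O\<^esub>" if "x \<in> conductor K R" for x
      using that unfolding cond by (auto simp: cgenideal_def)
    define N :: nat where "N = fact (card (a_rcosets\<^bsub>?O\<^esub> R))"
    have "add_pow ?O N \<one>\<^bsub>?O\<^esub> \<otimes>\<^bsub>?O\<^esub> y \<in> R" if "y \<in> carrier ?O" for y
      using O.finite_index_fact_mult[OF R that] O.add_pow_ldistr[of "\<one>\<^bsub>?O\<^esub>" y N] that
      by (simp add: N_def)
    then have "add_pow ?O N \<one>\<^bsub>?O\<^esub> \<in> conductor K R"
      using O.add.nat_pow_closed[OF O.one_closed, of N] by (simp add: conductor_def O_simps)
    then have "add_pow ?O N \<one>\<^bsub>?O\<^esub> = \<zero>\<^bsub>?O\<^esub>"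
      by (rule zero)
    then have "add_pow K N \<one>\<^bsub>K\<^esub> = \<zero>\<^bsub>K\<^esub>"
      by (simp add: add_pow_def nat_pow_def O_simps)
    then show False
      using K.char_zero[of N] by (simp add: N_def)
  qed
  then have prime: "ring_prime\<^bsub>?O\<^esub> \<pi>"
    using O.primeideal_iff_prime[of \<pi>] pi assms(5,6) by simp
  interpret prime_power_conductor ?O R \<pi> a
  proof (intro prime_power_conductor.intro prime_power_conductor_axioms.intro)
    show "domain ?O"
      by (rule O.domain_axioms)
    show "subring R ?O" "finite (a_rcosets\<^bsub>?O\<^esub> R)" "\<pi> \<in> carrier ?O" "ring_prime\<^bsub>?O\<^esub> \<pi>" "2 \<le> a"
      by fact+
    show "\<pi> [^]\<^bsub>?O\<^esub> a \<otimes>\<^bsub>?O\<^esub> x \<in> R" if "x \<in> carrier ?O" for x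
    proof -
      have "\<pi> [^]\<^bsub>?O\<^esub> a \<in> conductor K R"
        unfolding cond using pi by (intro O.cgenideal_self) simp
      then show ?thesis
        using that by (simp add: conductor_def O_simps)
    qed
    show "\<pi> [^]\<^bsub>?O\<^esub> a divides\<^bsub>?O\<^esub> x" if "x \<in> R" "\<pi> divides\<^bsub>?O\<^esub> x" for x
    proof -
      have "x \<in> P"
        using that(2) pi O.m_comm unfolding assms(5) cgenideal_def factor_def by blast
      then have "x \<in> PIdl\<^bsub>?O\<^esub> (\<pi> [^]\<^bsub>?O\<^esub> a)"
        using that(1) assms(9) cond by blast
      then show ?thesis
        using pi O.m_comm O.nat_pow_closed unfolding cgenideal_def factor_def by blast
    qed
    show "\<exists>u\<in>Units ?O. u \<otimes>\<^bsub>?O\<^esub> x \<in> R"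
      if "x \<in> carrier ?O" "PIdl\<^bsub>?O\<^esub> x <+>\<^bsub>?O\<^esub> PIdl\<^bsub>?O\<^esub> (\<pi> [^]\<^bsub>?O\<^esub> a) = carrier ?O" for x
      using assms(3) that unfolding locally_associated_order_def cond O_simps by blast
  qed
  have "K\<lparr>carrier := R\<rparr> = T"
    by (simp add: ring_of_integers_def)
  then have "elasticity (K\<lparr>carrier := R\<rparr>) = elasticity ?O"
    using elasticity_T_le[OF assms(10)] elasticity_S_le by simp
  moreover have "\<not> associated_order K R"
    using p_not_associated assms(4) by (auto simp: associated_order_def O_simps)
  ultimately show ?thesis
    by blast
qed

end
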